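(* There is a constant $C_J>0$, depending on the kernel $J$ but independent of $h$, such that the following holds. Let $K>1$ and let $\beta>0$ satisfy $\max_{s\in\mathbb{R}}|F_K''(s)|\le\beta$. Suppose $\beta$ and the time step $\tau>0$ satisfy $$\beta\le\frac{\gamma_0+1}{3},\qquad \tau\le\frac{2(\gamma_0+1-3\beta)}{C_J\varepsilon^4}.$$ Let $(u_h^n)_{n\ge0}$ in $\mathcal{C}^{per}_{N\times N}$, with $(u_h^1\|\mathbf 1)=(u_h^0\|\mathbf 1)$, satisfy for all $n\ge1$ the second-order linearly implicit (2LI) scheme $$\frac{3u_h^{n+1}-4u_h^n+u_h^{n-1}}{2\tau}=\Delta_h\omega_h^{n+1},\qquad \omega_h^{n+1}=2F_K'(u_h^n)-F_K'(u_h^{n-1})+\varepsilon^2[J\circledast\mathbf 1]u_h^{n+1}-\varepsilon^2[J\circledast u_h^{n+1}].$$ Then, with $\delta u_h^n:=u_h^n-u_h^{n-1}$ and $\widetilde E_{K,h}(u_h,v_h):=E_{K,h}(u_h)+\frac{\beta}{2}\|v_h\|_2^2+\frac{1}{4\tau}\|v_h\|_{-1}^2$, $$\widetilde E_{K,h}(u_h^{n+1},\delta u_h^{n+1})\le\widetilde E_{K,h}(u_h^n,\delta u_h^n)\qquad\text{for all } n\ge1.$$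
   Context: Setting. $\Omega=(0,L)\times(0,L)$, $h=L/N$ with $N\in\mathbb{Z}^+$, and $\varepsilon>0$. The kernel $J:\mathbb{R}^2\to\mathbb{R}$ is $C^\infty$, $\Omega$-periodic ($L$-periodic in each variable) and even ($J(\mathbf x)=J(-\mathbf x)$), with $J*1=\int_\Omega J\,d\mathbf x>0$. $\mathcal{C}^{per}_{N\times N}$ is the finite-dimensional space of real periodic cell-centered grid functions $\phi=(\phi_{i,j})$ (values at $((i-\tfrac12)h,(j-\tfrac12)h)$), extended $N$-periodically in both indices $i,j\in\mathbb{Z}$. $\mathbf 1$ is the constant grid function $1$; nonlinear functions of grid functions are taken componentwise. $(\phi\|\psi)=\sum_{i,j=1}^N\phi_{i,j}\psi_{i,j}$ and $\|\phi\|_2^2=h^2(\phi\|\phi)$. Discrete Laplacian: $(\Delta_h\phi)_{i,j}=h^{-2}(\phi_{i+1,j}+\phi_{i-1,j}+\phi_{i,j+1}+\phi_{i,j-1}-4\phi_{i,j})$. On the zero-mean space $\mathcal M_h^0=\{u\in\mathcal{C}^{per}_{N\times N}:(u\|\mathbf 1)=0\}$, $-\Delta_h$ is self-adjoint positive definite, hence invertible, and $\|u\|_{-1}:=\sqrt{h^2((-\Delta_h)^{-1}u\|u)}$ for $u\in\mathcal M_h^0$. (The increments $\delta u_h^n$ lie in $\mathcal M_h^0$.) Discrete convolution: with $J_{k+\frac12,l+\frac12}:=J(kh,lh)$, $[J\circledast\phi]_{i,j}=h^2\sum_{k=1}^N\sum_{l=1}^N J_{k+\frac12,l+\frac12}\,\phi_{i-k,j-l}$.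 $[J\circledast\mathbf 1]$ is a constant grid function, identified with the number $h^2\sum_{k,l=1}^N J(kh,lh)$. Standing assumption: $\gamma:=\varepsilon^2(J*1)-1>0$ and its discrete analogue $\gamma_0:=\varepsilon^2[J\circledast\mathbf 1]-1>0$. Modified potential $F_K\in C^2(\mathbb{R})$ for $K>1$: $F_K(u)=\frac14(u^2-1)^2$ for $|u|\le K$; $F_K(u)=\frac{3K^2-1}{2}u^2-2K^3u+\frac14(3K^4+1)$ for $u>K$; $F_K(u)=\frac{3K^2-1}{2}u^2+2K^3u+\frac14(3K^4+1)$ for $u<-K$. Discrete energy: $E_{K,h}(u_h)=h^2(F_K(u_h)\|\mathbf 1)+\frac{\varepsilon^2[J\circledast\mathbf 1]}{2}\|u_h\|_2^2-\frac{\varepsilon^2}{2}h^2(u_h\|[J\circledast u_h])$. *)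

theory Defs
  imports "HOL-Analysis.Analysis"
begin

fun k_smooth :: "nat \<Rightarrow> ('a::real_normed_vector \<Rightarrow> 'b::real_normed_vector) \<Rightarrow> bool" where
  "k_smooth 0 f \<longleftrightarrow> continuous_on UNIV f"
| "k_smooth (Suc k) f \<longleftrightarrow>
     (\<forall>x. f differentiable (at x)) \<and> (\<forall>v. k_smooth k (\<lambda>x. frechet_derivative f (at x) v))"

definition smooth :: "('a::real_normed_vector \<Rightarrow> 'b::real_normed_vector) \<Rightarrow> bool" where
  "smooth f \<longleftrightarrow> (\<forall>k. k_smooth k f)"

definition kernel_mass :: "real \<Rightarrow> (real \<times> real \<Rightarrow> real) \<Rightarrow> real" where
  "kernel_mass L J = integral (box (0, 0) (L, L)) J"

definition admissible_kernel :: "real \<Rightarrow> (real \<times> real \<Rightarrow> real) \<Rightarrow> bool" where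
  "admissible_kernel L J \<longleftrightarrow>
     smooth J \<and>
     (\<forall>x y. J (x + L, y) = J (x, y) \<and> J (x, y + L) = J (x, y)) \<and>
     (\<forall>x. J (- x) = J x) \<and>
     kernel_mass L J > 0"

text \<open>
  A grid function is stored with its periodic extension, as a function on all pairs of integers;
  the entry \<open>\<phi> i j\<close> is the value at the cell centre \<open>((i - 1/2) h, (j - 1/2) h)\<close>.
  Operations on grid functions take the side length \<open>L\<close> and the number \<open>N\<close> of cells per
  direction as parameters.
\<close>

type_synonym grid_fun = "int \<Rightarrow> int \<Rightarrow> real"

definition mesh :: "real \<Rightarrow> nat \<Rightarrow> real" where
  "mesh L N = L / real N"

definition Cper :: "nat \<Rightarrow> grid_fun set" where
  "Cper N = {\<phi>. \<forall>i j. \<phi> (i + int N) j = \<phi> i j \<and> \<phi> i (j + int N) = \<phi> i j}"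

definition grid_one :: grid_fun where
  "grid_one = (\<lambda>i j. 1)"

definition grid_inner :: "nat \<Rightarrow> grid_fun \<Rightarrow> grid_fun \<Rightarrow> real" where
  "grid_inner N \<phi> \<psi> = (\<Sum>i=1..int N. \<Sum>j=1..int N. \<phi> i j * \<psi> i j)"

definition grid_norm :: "real \<Rightarrow> nat \<Rightarrow> grid_fun \<Rightarrow> real" where
  "grid_norm L N \<phi> = sqrt ((mesh L N)\<^sup>2 * grid_inner N \<phi> \<phi>)"

definition lap :: "real \<Rightarrow> nat \<Rightarrow> grid_fun \<Rightarrow> grid_fun" where
  "lap L N \<phi> = (\<lambda>i j.
     (\<phi> (i + 1) j + \<phi> (i - 1) j + \<phi> i (j + 1) + \<phi> i (j - 1) - 4 * \<phi> i j) / (mesh L N)\<^sup>2)"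

definition zero_mean :: "nat \<Rightarrow> grid_fun set" where
  "zero_mean N = {u \<in> Cper N. grid_inner N u grid_one = 0}"

definition neg_lap :: "real \<Rightarrow> nat \<Rightarrow> grid_fun \<Rightarrow> grid_fun" where
  "neg_lap L N \<phi> = (\<lambda>i j. - lap L N \<phi> i j)"

definition inv_neg_lap :: "real \<Rightarrow> nat \<Rightarrow> grid_fun \<Rightarrow> grid_fun" where
  "inv_neg_lap L N = the_inv_into (zero_mean N) (neg_lap L N)"

text \<open>Meaningful on \<^term>\<open>zero_mean N\<close> only.\<close>

definition grid_norm_m1 :: "real \<Rightarrow> nat \<Rightarrow> grid_fun \<Rightarrow> real" where
  "grid_norm_m1 L N u = sqrt ((mesh L N)\<^sup>2 * grid_inner N (inv_neg_lap L N u) u)"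

text \<open>The kernel is sampled at the offsets \<open>(k h, l h)\<close> between cell centres.\<close>

definition conv :: "real \<Rightarrow> nat \<Rightarrow> (real \<times> real \<Rightarrow> real) \<Rightarrow> grid_fun \<Rightarrow> grid_fun" where
  "conv L N J \<phi> = (\<lambda>i j. (mesh L N)\<^sup>2 *
     (\<Sum>k=1..int N. \<Sum>l=1..int N.
        J (of_int k * mesh L N, of_int l * mesh L N) * \<phi> (i - k) (j - l)))"

definition conv_one :: "real \<Rightarrow> nat \<Rightarrow> (real \<times> real \<Rightarrow> real) \<Rightarrow> real" where
  "conv_one L N J = (mesh L N)\<^sup>2 *
     (\<Sum>k=1..int N. \<Sum>l=1..int N. J (of_int k * mesh L N, of_int l * mesh L N))"

lemma conv_grid_one: "conv L N J grid_one = (\<lambda>i j. conv_one L N J)"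
  by (simp add: conv_def conv_one_def grid_one_def)

definition gamma_cont :: "real \<Rightarrow> real \<Rightarrow> (real \<times> real \<Rightarrow> real) \<Rightarrow> real" where
  "gamma_cont \<epsilon> L J = \<epsilon>\<^sup>2 * kernel_mass L J - 1"

definition gamma_disc :: "real \<Rightarrow> real \<Rightarrow> nat \<Rightarrow> (real \<times> real \<Rightarrow> real) \<Rightarrow> real" where
  "gamma_disc \<epsilon> L N J = \<epsilon>\<^sup>2 * conv_one L N J - 1"

definition FK :: "real \<Rightarrow> real \<Rightarrow> real" where
  "FK K u =
    (if \<bar>u\<bar> \<le> K then (u\<^sup>2 - 1)\<^sup>2 / 4
     else if u > K then (3 * K\<^sup>2 - 1) / 2 * u\<^sup>2 - 2 * K ^ 3 * u + (3 * K ^ 4 + 1) / 4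
     else (3 * K\<^sup>2 - 1) / 2 * u\<^sup>2 + 2 * K ^ 3 * u + (3 * K ^ 4 + 1) / 4)"

definition energy ::
  "real \<Rightarrow> nat \<Rightarrow> (real \<times> real \<Rightarrow> real) \<Rightarrow> real \<Rightarrow> real \<Rightarrow> grid_fun \<Rightarrow> real" where
  "energy L N J \<epsilon> K u =
     (mesh L N)\<^sup>2 * grid_inner N (\<lambda>i j. FK K (u i j)) grid_one
     + \<epsilon>\<^sup>2 * conv_one L N J / 2 * (grid_norm L N u)\<^sup>2
     - \<epsilon>\<^sup>2 / 2 * (mesh L N)\<^sup>2 * grid_inner N u (conv L N J u)"

definition mod_energy ::
  "real \<Rightarrow> nat \<Rightarrow> (real \<times> real \<Rightarrow> real) \<Rightarrow> real \<Rightarrow> real \<Rightarrow> real \<Rightarrow> real \<Rightarrow> grid_fun \<Rightarrow> grid_fun \<Rightarrow> real"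
  where
  "mod_energy L N J \<epsilon> K \<beta> \<tau> u v =
     energy L N J \<epsilon> K u + \<beta> / 2 * (grid_norm L N v)\<^sup>2 + 1 / (4 * \<tau>) * (grid_norm_m1 L N v)\<^sup>2"

definition increment :: "(nat \<Rightarrow> grid_fun) \<Rightarrow> nat \<Rightarrow> grid_fun" where
  "increment u n = (\<lambda>i j. u n i j - u (n - 1) i j)"

text \<open>\<open>chem_pot L N J \<epsilon> K w v u\<close> is the chemical potential at the new level \<open>w\<close>, extrapolated
  from the current level \<open>v\<close> and the previous level \<open>u\<close>.\<close>

definition chem_pot ::
  "real \<Rightarrow> nat \<Rightarrow> (real \<times> real \<Rightarrow> real) \<Rightarrow> real \<Rightarrow> real \<Rightarrow> grid_fun \<Rightarrow> grid_fun \<Rightarrow> grid_fun \<Rightarrow> grid_fun"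
  where
  "chem_pot L N J \<epsilon> K w v u = (\<lambda>i j.
     2 * deriv (FK K) (v i j) - deriv (FK K) (u i j)
     + \<epsilon>\<^sup>2 * conv_one L N J * w i j - \<epsilon>\<^sup>2 * conv L N J w i j)"

definition scheme_2LI ::
  "real \<Rightarrow> nat \<Rightarrow> (real \<times> real \<Rightarrow> real) \<Rightarrow> real \<Rightarrow> real \<Rightarrow> real \<Rightarrow> (nat \<Rightarrow> grid_fun) \<Rightarrow> bool"
  where
  "scheme_2LI L N J \<epsilon> K \<tau> u \<longleftrightarrow>
     (\<forall>n\<ge>1. \<forall>i j.
        (3 * u (n + 1) i j - 4 * u n i j + u (n - 1) i j) / (2 * \<tau>)
        = lap L N (chem_pot L N J \<epsilon> K (u (n + 1)) (u n) (u (n - 1))) i j)"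

end

(*
Test the scheme with (-Lap)^{-1} w, where w is the new increment and v the old one. The time
difference 3 w - v yields (5 |w|_{-1}^2 - |v|_{-1}^2) / (4 tau); Taylor expansion with |F_K''| <= beta
compares the extrapolated nonlinearity with the increment of F_K up to beta |w|^2 + beta/2 |v|^2; the
quadratic part of the energy is differenced exactly by polarization, since J even makes the discrete
convolution self-adjoint. What is left is the term eps^2/2 (w, J*w). It equals
eps^2/2 (grad (J*w), grad (-Lap)^{-1} w), and a Lipschitz bound M for J on [0,2L]^2 gives
|grad (J*w)|^2 <= 2 M^2 L^4 |w|^2 uniformly in h, so Young's inequality absorbs it into
|w|_{-1}^2 / tau and (gamma_0 + 1 - 3 beta)/2 |w|^2. This gives C_J = M^2 L^4 / 2.
*)
theory Submission
  imports Defs "HOL-Library.Function_Algebras"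
begin

section \<open>Sums over one period\<close>

lemma sum_int_telescope:
  fixes g :: "int \<Rightarrow> real"
  shows "(\<Sum>i=1..int n. g (i + 1) - g i) = g (int n + 1) - g 1"
proof (induction n)
  case (Suc n)
  have "{1..int (Suc n)} = insert (int n + 1) {1..int n}" by auto
  then show ?case using Suc by (simp add: algebra_simps)
qed simp

text \<open>A shift by one changes the sum by a telescoping total \<open>f (N + 1) - f 1\<close> (up
  to an offset), which periodicity makes zero. Integer induction in both directions then reaches
  every shift.\<close>

lemma period_sum_shift:
  fixes f :: "int \<Rightarrow> real"
  assumes per: "\<And>i. f (i + int N) = f i"
  shows "(\<Sum>i=1..int N. f (i + a)) = (\<Sum>i=1..int N. f i)"
proof -
  have step: "(\<Sum>i=1..int N. f (i + (b + 1))) = (\<Sum>i=1..int N. f (i + b))" for b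
    using sum_int_telescope[of "\<lambda>i. f (i + b)" N] per[of "1 + b"]
    by (simp add: sum_subtractf algebra_simps)
  show ?thesis
  proof (induction a rule: int_induct[where k = 0])
    case (step1 b)
    then show ?case using step[of b] by simp
  next
    case (step2 b)
    then show ?case using step[of "b - 1"] by simp
  qed simp
qed

text \<open>The substitution \<open>i\<close> to \<open>N + 1 - i\<close> preserves the index range
  and, modulo the period, turns the reflection into a shift by -1.\<close>

lemma period_sum_reflect:
  fixes f :: "int \<Rightarrow> real"
  assumes per: "\<And>i. f (i + int N) = f i"
  shows "(\<Sum>i=1..int N. f (- i)) = (\<Sum>i=1..int N. f i)"
proof -
  have "(\<Sum>i=1..int N. f (- i)) = (\<Sum>i=1..int N. f (- (int N + 1 - i)))"
    by (rule sum.reindex_bij_witness[of _ "\<lambda>i. int N + 1 - i" "\<lambda>i. int N + 1 - i"]) auto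
  also have "\<dots> = (\<Sum>i=1..int N. f (i + (-1)))"
    using per[of "_ - 1 - int N"] by (intro sum.cong) (auto simp: algebra_simps)
  finally show ?thesis using period_sum_shift[of f N "-1", OF per] by simp
qed

section \<open>Unweighted sums over one cell of the doubly periodic grid\<close>

definition gsum :: "nat \<Rightarrow> grid_fun \<Rightarrow> real" where
  "gsum N f = (\<Sum>i=1..int N. \<Sum>j=1..int N. f i j)"

lemma grid_inner_gsum: "grid_inner N f g = gsum N (\<lambda>i j. f i j * g i j)"
  by (simp add: grid_inner_def gsum_def)

lemma grid_inner_grid_one: "grid_inner N f grid_one = gsum N f"
  by (simp add: grid_inner_gsum grid_one_def)

lemma gsum_add: "gsum N (\<lambda>i j. f i j + g i j) = gsum N f + gsum N g"
  and gsum_diff: "gsum N (\<lambda>i j. f i j - g i j) = gsum N f - gsum N g"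
  and gsum_minus: "gsum N (\<lambda>i j. - f i j) = - gsum N f"
  and gsum_cmult: "gsum N (\<lambda>i j. c * f i j) = c * gsum N f"
  and gsum_cmult_right: "gsum N (\<lambda>i j. f i j * c) = gsum N f * c"
  and gsum_divide: "gsum N (\<lambda>i j. f i j / c) = gsum N f / c"
  by (simp_all add: gsum_def sum.distrib sum_subtractf sum_negf sum_distrib_left
      sum_distrib_right sum_divide_distrib)

lemmas gsum_linear = gsum_add gsum_diff gsum_minus gsum_cmult gsum_cmult_right gsum_divide

lemma gsum_const: "gsum N (\<lambda>i j. c) = (real N)\<^sup>2 * c"
  by (simp add: gsum_def power2_eq_square)

lemma gsum_mono: "(\<And>i j. f i j \<le> g i j) \<Longrightarrow> gsum N f \<le> gsum N g"
  unfolding gsum_def by (intro sum_mono)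

lemma gsum_nonneg: "(\<And>i j. 0 \<le> f i j) \<Longrightarrow> 0 \<le> gsum N f"
  unfolding gsum_def by (intro sum_nonneg)

text \<open>As a single sum over a product set, a grid sum is open to the one-index Cauchy-Schwarz
  inequality and to interchange of summation.\<close>

lemma gsum_prod: "gsum N f = (\<Sum>(i, j)\<in>{1..int N} \<times> {1..int N}. f i j)"
  unfolding gsum_def by (rule sum.cartesian_product)

lemma gsum_swap: "gsum N (\<lambda>i j. gsum N (\<lambda>k l. f i j k l)) = gsum N (\<lambda>k l. gsum N (\<lambda>i j. f i j k l))"
  unfolding gsum_prod split_def by (rule sum.swap)

lemma gsum_Cauchy_Schwarz:
  "(gsum N (\<lambda>i j. f i j * g i j))\<^sup>2 \<le> gsum N (\<lambda>i j. (f i j)\<^sup>2) * gsum N (\<lambda>i j. (g i j)\<^sup>2)"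
  using Cauchy_Schwarz_ineq_sum[of "\<lambda>(i, j). f i j" "\<lambda>(i, j). g i j" "{1..int N} \<times> {1..int N}"]
  by (simp add: gsum_prod split_def)

lemma CperD:
  assumes "f \<in> Cper N"
  shows "f (i + int N) j = f i j" "f i (j + int N) = f i j"
  using assms by (auto simp: Cper_def)

lemma CperI:
  assumes "\<And>i j. f (i + int N) j = f i j" "\<And>i j. f i (j + int N) = f i j"
  shows "f \<in> Cper N"
  using assms by (auto simp: Cper_def)

lemma Cper_pointwise2:
  assumes "f \<in> Cper N" "g \<in> Cper N"
  shows "(\<lambda>i j. F (f i j) (g i j)) \<in> Cper N"
  using assms by (simp add: Cper_def)

lemma Cper_pointwise: "f \<in> Cper N \<Longrightarrow> (\<lambda>i j. F (f i j)) \<in> Cper N"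
  by (simp add: Cper_def)

lemma Cper_shift:
  assumes "f \<in> Cper N"
  shows "(\<lambda>i j. f (i + a) (j + b)) \<in> Cper N"
  using CperD[OF assms, of "_ + a" "_ + b"]
  by (intro CperI) (simp_all add: algebra_simps)

lemma Cper_reflect:
  assumes "f \<in> Cper N"
  shows "(\<lambda>i j. f (a - i) (b - j)) \<in> Cper N"
proof (rule CperI)
  fix i j
  show "f (a - (i + int N)) (b - j) = f (a - i) (b - j)"
    using CperD(1)[OF assms, of "a - i - int N"] by (simp add: algebra_simps)
  show "f (a - i) (b - (j + int N)) = f (a - i) (b - j)"
    using CperD(2)[OF assms, of _ "b - j - int N"] by (simp add: algebra_simps)
qed

lemma gsum_shift:
  assumes "f \<in> Cper N"
  shows "gsum N (\<lambda>i j. f (i + a) (j + b)) = gsum N f"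
proof -
  have "gsum N (\<lambda>i j. f (i + a) (j + b)) = (\<Sum>i=1..int N. \<Sum>j=1..int N. f (i + a) j)"
    unfolding gsum_def by (intro sum.cong refl period_sum_shift CperD[OF assms])
  also have "\<dots> = gsum N f"
    unfolding gsum_def by (rule period_sum_shift) (simp add: CperD[OF assms])
  finally show ?thesis .
qed

lemma gsum_reflect0:
  assumes "f \<in> Cper N"
  shows "gsum N (\<lambda>i j. f (- i) (- j)) = gsum N f"
proof -
  have "gsum N (\<lambda>i j. f (- i) (- j)) = (\<Sum>i=1..int N. \<Sum>j=1..int N. f (- i) j)"
    unfolding gsum_def by (intro sum.cong refl period_sum_reflect CperD[OF assms])
  also have "\<dots> = gsum N f"
    unfolding gsum_def
    by (rule period_sum_reflect[of "\<lambda>i. \<Sum>j=1..int N. f i j"]) (simp add: CperD[OF assms])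
  finally show ?thesis .
qed

lemma gsum_reflect:
  assumes "f \<in> Cper N"
  shows "gsum N (\<lambda>i j. f (a - i) (b - j)) = gsum N f"
  using gsum_reflect0[OF Cper_shift[OF assms, of a b]] gsum_shift[OF assms, of a b]
  by (simp add: algebra_simps)


section \<open>The discrete Laplacian\<close>

text \<open>This is the discrete inner product of the gradients of \<open>f\<close> and
  \<open>g\<close>. In two dimensions the area weight \<open>h^2\<close> cancels the
  \<open>1/h^2\<close> of the two difference quotients, so no mesh factor appears.\<close>

definition dirichlet_form :: "nat \<Rightarrow> grid_fun \<Rightarrow> grid_fun \<Rightarrow> real" where
  "dirichlet_form N f g = gsum N (\<lambda>i j.
     (f (i + 1) j - f i j) * (g (i + 1) j - g i j) + (f i (j + 1) - f i j) * (g i (j + 1) - g i j))"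

lemma Cper_neg_lap: "f \<in> Cper N \<Longrightarrow> neg_lap L N f \<in> Cper N"
proof -
  assume f: "f \<in> Cper N"
  have "f (i + int N + 1) j = f (i + 1) j" "f (i + int N - 1) j = f (i - 1) j"
    "f i (j + int N + 1) = f i (j + 1)" "f i (j + int N - 1) = f i (j - 1)" for i j
    using CperD(1)[OF f, of "i + 1"] CperD(1)[OF f, of "i - 1"]
      CperD(2)[OF f, of i "j + 1"] CperD(2)[OF f, of i "j - 1"]
    by (simp_all add: algebra_simps)
  then show ?thesis
    by (intro CperI) (simp_all add: neg_lap_def lap_def CperD[OF f])
qed

lemma mesh_pos: "L > 0 \<Longrightarrow> N \<ge> 1 \<Longrightarrow> mesh L N > 0"
  by (simp add: mesh_def)

text \<open>Expanding the products of differences leaves terms with \<open>f\<close> at a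
  neighbouring cell. Periodicity shifts these back to cell \<open>(i, j)\<close>, where the
  differences of \<open>g\<close> combine into the five-point stencil without boundary
  terms.\<close>

lemma summation_by_parts:
  assumes L: "L > 0" "N \<ge> 1" and f: "f \<in> Cper N" and g: "g \<in> Cper N"
  shows "(mesh L N)\<^sup>2 * grid_inner N f (neg_lap L N g) = dirichlet_form N f g"
proof -
  have h: "mesh L N \<noteq> 0" using mesh_pos[OF L] by simp
  have 1: "gsum N (\<lambda>i j. f (i + 1) j * (g (i + 1) j - g i j)) = gsum N (\<lambda>i j. f i j * (g i j - g (i - 1) j))"
    using gsum_shift[OF Cper_pointwise2[OF f Cper_pointwise2[OF g Cper_shift[OF g, of "-1" 0], of minus], of times], of 1 0]
    by simp
  have 2: "gsum N (\<lambda>i j. f i (j + 1) * (g i (j + 1) - g i j)) = gsum N (\<lambda>i j. f i j * (g i j - g i (j - 1)))"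
    using gsum_shift[OF Cper_pointwise2[OF f Cper_pointwise2[OF g Cper_shift[OF g, of 0 "-1"], of minus], of times], of 0 1]
    by simp
  have "dirichlet_form N f g =
      gsum N (\<lambda>i j. f (i + 1) j * (g (i + 1) j - g i j)) - gsum N (\<lambda>i j. f i j * (g (i + 1) j - g i j))
    + (gsum N (\<lambda>i j. f i (j + 1) * (g i (j + 1) - g i j)) - gsum N (\<lambda>i j. f i j * (g i (j + 1) - g i j)))"
    unfolding dirichlet_form_def gsum_add[symmetric] gsum_diff[symmetric]
    by (simp add: algebra_simps)
  also have "\<dots> = gsum N (\<lambda>i j. f i j *
      (4 * g i j - g (i + 1) j - g (i - 1) j - g i (j + 1) - g i (j - 1)))"
    unfolding 1 2 gsum_add[symmetric] gsum_diff[symmetric]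
    by (simp add: algebra_simps)
  also have "\<dots> = (mesh L N)\<^sup>2 * grid_inner N f (neg_lap L N g)"
  proof -
    have "f i j * (4 * g i j - g (i + 1) j - g (i - 1) j - g i (j + 1) - g i (j - 1)) =
        (mesh L N)\<^sup>2 * (f i j * neg_lap L N g i j)" for i j
      using h unfolding neg_lap_def lap_def by (simp add: divide_simps) (simp add: algebra_simps)
    then show ?thesis by (simp only: grid_inner_gsum gsum_cmult[symmetric])
  qed
  finally show ?thesis by simp
qed

lemma dirichlet_form_commute: "dirichlet_form N f g = dirichlet_form N g f"
  by (simp add: dirichlet_form_def mult.commute)

lemma dirichlet_form_nonneg: "0 \<le> dirichlet_form N f f"
  unfolding dirichlet_form_def by (intro gsum_nonneg) simp

lemma neg_lap_self_adjoint:
  assumes "L > 0" "N \<ge> 1" "f \<in> Cper N" "g \<in> Cper N"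
  shows "grid_inner N f (neg_lap L N g) = grid_inner N (neg_lap L N f) g"
proof -
  have "(mesh L N)\<^sup>2 * grid_inner N f (neg_lap L N g) = (mesh L N)\<^sup>2 * grid_inner N g (neg_lap L N f)"
    using summation_by_parts[OF assms] summation_by_parts[OF assms(1,2,4,3)]
      dirichlet_form_commute[of N f g] by simp
  then have "grid_inner N f (neg_lap L N g) = grid_inner N g (neg_lap L N f)"
    using mesh_pos[OF assms(1,2)] by simp
  then show ?thesis by (simp add: grid_inner_gsum mult.commute)
qed

text \<open>Self-adjointness moves the Laplacian onto the constant 1, which it annihilates. This
  gives both the invariance of the zero-mean space and the conservation of mass by the
  scheme.\<close>

lemma gsum_neg_lap:
  assumes "L > 0" "N \<ge> 1" "f \<in> Cper N"
  shows "grid_inner N (neg_lap L N f) grid_one = 0"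
proof -
  have "grid_one \<in> Cper N" by (simp add: Cper_def grid_one_def)
  then have "grid_inner N (neg_lap L N f) grid_one = grid_inner N f (neg_lap L N grid_one)"
    using neg_lap_self_adjoint assms by simp
  then show ?thesis
    by (simp add: grid_inner_gsum neg_lap_def lap_def grid_one_def gsum_const)
qed

lemma neg_lap_zero_mean:
  assumes "L > 0" "N \<ge> 1" "f \<in> Cper N"
  shows "neg_lap L N f \<in> zero_mean N"
  using Cper_neg_lap gsum_neg_lap assms by (simp add: zero_mean_def)

text \<open>The sum sees only the indices 1 to \<open>N\<close>, so the function is first translated
  to bring the arbitrary cell \<open>(i, j)\<close> to position \<open>(1, 1)\<close>.\<close>

lemma gsum_eq_0D:
  assumes f: "f \<in> Cper N" and N: "N \<ge> 1" and nn: "\<And>i j. 0 \<le> f i j" and 0: "gsum N f = 0"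
  shows "f i j = 0"
proof -
  have "gsum N (\<lambda>k l. f (k + (i - 1)) (l + (j - 1))) = 0"
    using gsum_shift[OF f] 0 by simp
  then have "\<forall>k\<in>{1..int N}. (\<Sum>l=1..int N. f (k + (i - 1)) (l + (j - 1))) = 0"
    unfolding gsum_def by (subst (asm) sum_nonneg_eq_0_iff) (auto intro: sum_nonneg nn)
  then have "(\<Sum>l=1..int N. f i (l + (j - 1))) = 0" using N by force
  then have "\<forall>l\<in>{1..int N}. f i (l + (j - 1)) = 0"
    by (subst (asm) sum_nonneg_eq_0_iff) (auto intro: nn)
  then show ?thesis using N by force
qed

lemma int_shift_invariant_const:
  fixes f :: "int \<Rightarrow> 'a"
  assumes "\<And>i. f (i + 1) = f i"
  shows "f i = f 0"
proof (induction i rule: int_induct[where k = 0])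
  case (step2 i)
  then show ?case using assms[of "i - 1"] by simp
qed (simp_all add: assms)

text \<open>A kernel element has zero Dirichlet energy, so all its forward differences vanish and it
  is constant. The zero mean then excludes every constant but 0.\<close>

lemma neg_lap_eq_0D:
  assumes L: "L > 0" "N \<ge> 1" and f: "f \<in> zero_mean N" and eq: "neg_lap L N f = (\<lambda>i j. 0)"
  shows "f = (\<lambda>i j. 0)"
proof -
  have fp: "f \<in> Cper N" and f0: "gsum N f = 0"
    using f by (auto simp: zero_mean_def grid_inner_gsum grid_one_def)
  have "dirichlet_form N f f = 0"
    using summation_by_parts[OF L fp fp] eq by (simp add: grid_inner_gsum gsum_const)
  then have "gsum N (\<lambda>i j. (f (i + 1) j - f i j)\<^sup>2 + (f i (j + 1) - f i j)\<^sup>2) = 0"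
    by (simp add: dirichlet_form_def power2_eq_square)
  moreover have "(\<lambda>i j. (f (i + 1) j - f i j)\<^sup>2 + (f i (j + 1) - f i j)\<^sup>2) \<in> Cper N"
    using Cper_shift[OF fp, of 1 0] Cper_shift[OF fp, of 0 1] fp by (simp add: Cper_def)
  ultimately have "(f (i + 1) j - f i j)\<^sup>2 + (f i (j + 1) - f i j)\<^sup>2 = 0" for i j
    using gsum_eq_0D[OF _ L(2)] by (metis (no_types, lifting) add_nonneg_nonneg zero_le_power2)
  then have "f (i + 1) j = f i j" "f i (j + 1) = f i j" for i j
    by (simp_all add: sum_power2_eq_zero_iff)
  then have "f i j = f 0 0" for i j
    using int_shift_invariant_const[of "\<lambda>i. f i j" i] int_shift_invariant_const[of "f 0" j] by simp
  then have const: "f = (\<lambda>i j. f 0 0)" by blast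
  then have "(real N)\<^sup>2 * f 0 0 = 0" using f0 gsum_const[of N "f 0 0"] by metis
  then have "f 0 0 = 0" using L by simp
  then show ?thesis using const by simp
qed

section \<open>Invertibility of the discrete Laplacian on the zero-mean space, by finite
  dimension\<close>

interpretation grid: vector_space "\<lambda>c (f :: grid_fun) i j. c * f i j"
  by unfold_locales (auto simp: fun_eq_iff algebra_simps)

text \<open>The ambient space of all functions on pairs of integers is infinite-dimensional, so
  finiteness enters through a finite set \<open>T\<close> whose span contains \<open>V\<close>.
  Injectivity sends a basis \<open>B\<close> of \<open>V\<close> to an independent set of the same
  size. A vector of \<open>V\<close> outside its span would give an independent subset of
  \<open>span B\<close> larger than \<open>B\<close>.\<close>

lemma (in vector_space) injective_on_finite_dim_imp_surjective:
  assumes V: "subspace V" and T: "finite T" "V \<subseteq> span T"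
    and lin: "module_hom scale scale f" and fV: "f ` V \<subseteq> V"
    and inj: "\<And>x. x \<in> V \<Longrightarrow> f x = 0 \<Longrightarrow> x = 0"
  shows "f ` V = V"
proof -
  interpret f: module_hom scale scale f by fact
  obtain B where B: "B \<subseteq> V" "independent B" "V \<subseteq> span B"
    by (rule maximal_independent_subset)
  have spB: "span B = V" using B V by (metis span_minimal subset_antisym)
  have finB: "finite B" using independent_span_bound[OF T(1) B(2)] B(1) T(2) by blast
  have "inj_on f (span B)"
    using inj V unfolding spB f.inj_on_iff_eq_0[OF V] by blast
  then have ind: "independent (f ` B)"
    using B(2) f.independent_injective_image by blast
  have card: "card (f ` B) = card B"
    using \<open>inj_on f (span B)\<close> by (meson card_image inj_on_subset span_superset)
  have "V \<subseteq> span (f ` B)"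
  proof
    fix x assume x: "x \<in> V"
    show "x \<in> span (f ` B)"
    proof (rule ccontr)
      assume nx: "x \<notin> span (f ` B)"
      then have "independent (insert x (f ` B))" using ind by (rule independent_insertI)
      moreover have "insert x (f ` B) \<subseteq> span B" using x B(1) fV spB by auto
      ultimately have "card (insert x (f ` B)) \<le> card B"
        using independent_span_bound[OF finB] by blast
      moreover have "x \<notin> f ` B" using nx span_base by blast
      ultimately show False using finB card by simp
    qed
  qed
  then have "V \<subseteq> f ` V" using f.span_image[of B] spB by simp
  then show ?thesis using fV by blast
qed


text \<open>The spanning set consists of the indicator functions of the pairs of residue classes
  modulo \<open>N\<close>, with the values of \<open>f\<close> on representatives as
  coefficients.\<close>

lemma finite_span_Cper:
  assumes "N \<ge> 1"
  obtains T where "finite T" "Cper N \<subseteq> grid.span T"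
proof -
  define e :: "int \<Rightarrow> int \<Rightarrow> grid_fun" where
    "e = (\<lambda>a b i j. if i mod int N = a \<and> j mod int N = b then 1 else 0)"
  define I where "I = {0..<int N}"
  have fun_sum: "(\<Sum>x\<in>A. F x) i j = (\<Sum>x\<in>A. F x i j)" for A :: "int set" and F :: "int \<Rightarrow> grid_fun" and i j
    by (induction A rule: infinite_finite_induct) simp_all
  have "f \<in> grid.span ((\<lambda>(a, b). e a b) ` (I \<times> I))" if f: "f \<in> Cper N" for f
  proof -
    have shift: "f (i + int N * k) j = f i j" for i j k
    proof (induction k rule: int_induct[where k = 0])
      case (step1 k)
      then show ?case using CperD(1)[OF f, of "i + int N * k" j] by (simp add: algebra_simps)
    next
      case (step2 k)
      then show ?case using CperD(1)[OF f, of "i + int N * (k - 1)" j] by (simp add: algebra_simps)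
    qed simp
    have shift': "f i (j + int N * k) = f i j" for i j k
    proof (induction k rule: int_induct[where k = 0])
      case (step1 k)
      then show ?case using CperD(2)[OF f, of i "j + int N * k"] by (simp add: algebra_simps)
    next
      case (step2 k)
      then show ?case using CperD(2)[OF f, of i "j + int N * (k - 1)"] by (simp add: algebra_simps)
    qed simp
    have modf: "f (i mod int N) (j mod int N) = f i j" for i j
      using shift[of "i mod int N" "i div int N" "j mod int N"]
        shift'[of i "j mod int N" "j div int N"] by simp
    have "f = (\<Sum>a\<in>I. \<Sum>b\<in>I. (\<lambda>i j. f a b * e a b i j))"
    proof (intro ext)
      fix i j
      \<comment> \<open>At a fixed cell only the pair of residues of \<open>i\<close> and
        \<open>j\<close> contributes, and there \<open>f\<close> has the same value as at
        \<open>(i, j)\<close> by periodicity.\<close>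
      have "(\<Sum>a\<in>I. \<Sum>b\<in>I. (\<lambda>i j. f a b * e a b i j)) i j
          = (\<Sum>a\<in>I. \<Sum>b\<in>I. if i mod int N = a then if j mod int N = b then f a b else 0 else 0)"
        unfolding fun_sum by (intro sum.cong) (auto simp: e_def)
      also have "\<dots> = (\<Sum>a\<in>I. if i mod int N = a then (\<Sum>b\<in>I. if j mod int N = b then f a b else 0) else 0)"
        by (intro sum.cong) auto
      also have "\<dots> = f (i mod int N) (j mod int N)"
        using assms by (simp add: I_def)
      finally show "f i j = (\<Sum>a\<in>I. \<Sum>b\<in>I. (\<lambda>i j. f a b * e a b i j)) i j"
        by (simp add: modf)
    qed
    also have "\<dots> \<in> grid.span ((\<lambda>(a, b). e a b) ` (I \<times> I))"
      by (intro grid.span_sum grid.span_scale[where c = "f _ _"] grid.span_base) auto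
    finally show ?thesis .
  qed
  then show ?thesis using that[of "(\<lambda>(a, b). e a b) ` (I \<times> I)"] by (auto simp: I_def)
qed

text \<open>Trivial kernel plus finite dimension. This is what makes the \<open>the_inv_into\<close>
  in \<open>inv_neg_lap\<close> a genuine two-sided inverse on the zero-mean space.\<close>

lemma bij_neg_lap:
  assumes L: "L > 0" "N \<ge> 1"
  shows "bij_betw (neg_lap L N) (zero_mean N) (zero_mean N)"
proof -
  let ?s = "\<lambda>c (f :: grid_fun) i j. c * f i j"
  have sub: "grid.subspace (zero_mean N)"
    by (rule grid.subspaceI)
      (auto simp: zero_mean_def Cper_def grid_inner_gsum grid_one_def gsum_linear gsum_const
          plus_fun_def zero_fun_def)
  have hom: "module_hom ?s ?s (neg_lap L N)"
    by unfold_locales (auto simp: fun_eq_iff neg_lap_def lap_def diff_divide_distrib add_divide_distrib algebra_simps)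
  interpret lap: module_hom ?s ?s "neg_lap L N" by (rule hom)
  have self: "neg_lap L N ` zero_mean N \<subseteq> zero_mean N"
    using neg_lap_zero_mean[OF L] by (auto simp: zero_mean_def)
  have ker: "f = 0" if "f \<in> zero_mean N" "neg_lap L N f = 0" for f
    using neg_lap_eq_0D[OF L] that by (simp add: zero_fun_def)
  obtain T where T: "finite T" "Cper N \<subseteq> grid.span T" by (rule finite_span_Cper[OF L(2)])
  have "zero_mean N \<subseteq> grid.span T" using T by (auto simp: zero_mean_def)
  then have "neg_lap L N ` zero_mean N = zero_mean N"
    using grid.injective_on_finite_dim_imp_surjective[OF sub T(1) _ hom self ker] by blast
  moreover have "inj_on (neg_lap L N) (zero_mean N)"
    using lap.inj_on_iff_eq_0[OF sub] ker by blast
  ultimately show ?thesis by (simp add: bij_betw_def)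
qed

lemma
  assumes "L > 0" "N \<ge> 1" "w \<in> zero_mean N"
  shows inv_neg_lap_zero_mean: "inv_neg_lap L N w \<in> zero_mean N"
    and neg_lap_inv_neg_lap: "neg_lap L N (inv_neg_lap L N w) = w"
  using bij_neg_lap[OF assms(1,2)] assms(3) unfolding inv_neg_lap_def bij_betw_def
  by (simp_all add: the_inv_into_into f_the_inv_into_f)

text \<open>The dual norm of \<open>w\<close> is the Dirichlet energy of its potential. The radicand
  is therefore nonnegative, so squaring undoes the square root.\<close>

lemma grid_norm_m1_sq:
  assumes L: "L > 0" "N \<ge> 1" and w: "w \<in> zero_mean N"
  shows "(grid_norm_m1 L N w)\<^sup>2 = dirichlet_form N (inv_neg_lap L N w) (inv_neg_lap L N w)"
proof -
  have "inv_neg_lap L N w \<in> Cper N"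
    using inv_neg_lap_zero_mean[OF L w] by (simp add: zero_mean_def)
  then have "(mesh L N)\<^sup>2 * grid_inner N (inv_neg_lap L N w) w
      = dirichlet_form N (inv_neg_lap L N w) (inv_neg_lap L N w)"
    using summation_by_parts[OF L, of "inv_neg_lap L N w" "inv_neg_lap L N w"]
      neg_lap_inv_neg_lap[OF L w] by simp
  then show ?thesis by (simp add: grid_norm_m1_def dirichlet_form_nonneg)
qed

section \<open>The discrete convolution\<close>

text \<open>The sampled kernel is itself treated as a periodic grid function, so that the shift and
  reflection rules for grid sums apply to it.\<close>

definition grid_kernel :: "real \<Rightarrow> nat \<Rightarrow> (real \<times> real \<Rightarrow> real) \<Rightarrow> grid_fun" where
  "grid_kernel L N J = (\<lambda>k l. J (of_int k * mesh L N, of_int l * mesh L N))"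

lemma conv_grid_kernel:
  "conv L N J f = (\<lambda>i j. (mesh L N)\<^sup>2 * gsum N (\<lambda>k l. grid_kernel L N J k l * f (i - k) (j - l)))"
  by (simp add: conv_def gsum_def grid_kernel_def)

lemma Cper_grid_kernel:
  assumes "N \<ge> 1" and "\<And>x y. J (x + L, y) = J (x, y)" "\<And>x y. J (x, y + L) = J (x, y)"
  shows "grid_kernel L N J \<in> Cper N"
proof -
  have "of_int (i + int N) * mesh L N = of_int i * mesh L N + L" for i
    using assms(1) by (simp add: mesh_def field_simps)
  then show ?thesis by (intro CperI) (simp_all add: grid_kernel_def assms(2,3))
qed

lemma grid_kernel_even:
  assumes "\<And>x. J (- x) = J x"
  shows "grid_kernel L N J (- k) (- l) = grid_kernel L N J k l"
  using assms[of "(of_int k * mesh L N, of_int l * mesh L N)"] by (simp add: grid_kernel_def)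

lemma Cper_conv:
  assumes f: "f \<in> Cper N"
  shows "conv L N J f \<in> Cper N"
proof (rule CperI)
  fix i j
  show "conv L N J f (i + int N) j = conv L N J f i j"
    using CperD(1)[OF f, of "i - _"] by (simp add: conv_def algebra_simps)
  show "conv L N J f i (j + int N) = conv L N J f i j"
    using CperD(2)[OF f, of _ "j - _"] by (simp add: conv_def algebra_simps)
qed

lemma conv_add: "conv L N J (\<lambda>i j. f i j + g i j) = (\<lambda>i j. conv L N J f i j + conv L N J g i j)"
  by (simp add: conv_grid_kernel distrib_left gsum_add)

text \<open>After exchanging the two grid sums, a shift of \<open>(i, j)\<close> by
  \<open>(k, l)\<close> moves the offset from \<open>g\<close> to \<open>f\<close>. Reflecting
  \<open>(k, l)\<close> and using that \<open>J\<close> is even restores the form of a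
  convolution.\<close>

lemma conv_self_adjoint:
  assumes f: "f \<in> Cper N" and g: "g \<in> Cper N" and J: "grid_kernel L N J \<in> Cper N"
    and even: "\<And>x. J (- x) = J x"
  shows "grid_inner N f (conv L N J g) = grid_inner N (conv L N J f) g"
proof -
  let ?J = "grid_kernel L N J"
  have "grid_inner N f (conv L N J g) =
      (mesh L N)\<^sup>2 * gsum N (\<lambda>i j. gsum N (\<lambda>k l. f i j * (?J k l * g (i - k) (j - l))))"
    by (simp add: grid_inner_gsum conv_grid_kernel gsum_cmult[symmetric] mult.left_commute)
  also have "gsum N (\<lambda>i j. gsum N (\<lambda>k l. f i j * (?J k l * g (i - k) (j - l))))
      = gsum N (\<lambda>k l. gsum N (\<lambda>i j. f i j * (?J k l * g (i - k) (j - l))))"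
    by (rule gsum_swap)
  also have "\<dots> = gsum N (\<lambda>k l. gsum N (\<lambda>i j. f (i + k) (j + l) * (?J k l * g i j)))"
  proof -
    have "gsum N (\<lambda>i j. f i j * (?J k l * g (i - k) (j - l)))
        = gsum N (\<lambda>i j. f (i + k) (j + l) * (?J k l * g i j))" for k l
    proof -
      have "(\<lambda>i j. f i j * (?J k l * g (i - k) (j - l))) \<in> Cper N"
        using Cper_pointwise2[OF f Cper_shift[OF g, of "-k" "-l"], of "\<lambda>x y. x * (?J k l * y)"] by simp
      from gsum_shift[OF this, of k l] show ?thesis by simp
    qed
    then show ?thesis by simp
  qed
  also have "\<dots> = gsum N (\<lambda>i j. gsum N (\<lambda>k l. f (i + k) (j + l) * (?J k l * g i j)))"
    by (rule gsum_swap)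
  also have "\<dots> = gsum N (\<lambda>i j. gsum N (\<lambda>k l. ?J k l * f (i - k) (j - l) * g i j))"
  proof -
    have "gsum N (\<lambda>k l. f (i + k) (j + l) * (?J k l * g i j))
        = gsum N (\<lambda>k l. ?J k l * f (i - k) (j - l) * g i j)" for i j
    proof -
      have "(\<lambda>k l. ?J k l * f (i - k) (j - l) * g i j) \<in> Cper N"
        using Cper_pointwise2[OF J Cper_reflect[OF f, of i j], of "\<lambda>x y. x * y * g i j"] .
      from gsum_reflect[OF this, of 0 0] show ?thesis
        by (simp add: grid_kernel_even[of J, OF even] mult_ac)
    qed
    then show ?thesis by simp
  qed
  finally show ?thesis
    by (simp add: grid_inner_gsum conv_grid_kernel gsum_cmult[symmetric] gsum_cmult_right[symmetric] mult_ac)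
qed

section \<open>Mesh-independent bound for the discrete gradient of a convolution\<close>

lemma gsum_conv_sq_le:
  assumes w: "w \<in> Cper N" and a: "\<And>k l. k \<in> {1..int N} \<Longrightarrow> l \<in> {1..int N} \<Longrightarrow> \<bar>a k l\<bar> \<le> A"
  shows "gsum N (\<lambda>i j. (gsum N (\<lambda>k l. a k l * w (i - k) (j - l)))\<^sup>2)
      \<le> A\<^sup>2 * real N ^ 4 * gsum N (\<lambda>i j. (w i j)\<^sup>2)"
proof -
  have A: "gsum N (\<lambda>k l. (a k l)\<^sup>2) \<le> (real N)\<^sup>2 * A\<^sup>2"
  proof -
    have "(a k l)\<^sup>2 \<le> A\<^sup>2" if "k \<in> {1..int N}" "l \<in> {1..int N}" for k l
      using a[OF that] abs_le_square_iff[of "a k l" A] by linarith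
    then have "gsum N (\<lambda>k l. (a k l)\<^sup>2) \<le> gsum N (\<lambda>k l. A\<^sup>2)"
      unfolding gsum_def by (intro sum_mono)
    then show ?thesis by (simp add: gsum_const)
  qed
  \<comment> \<open>Cauchy-Schwarz at each fixed cell: the reflected sum of the squares of
    \<open>w\<close> is its full sum whatever \<open>(i, j)\<close> is. Summing this bound over the
    \<open>N^2\<close> cells supplies the second factor \<open>N^2\<close>.\<close>
  have "(gsum N (\<lambda>k l. a k l * w (i - k) (j - l)))\<^sup>2 \<le> (real N)\<^sup>2 * A\<^sup>2 * gsum N (\<lambda>i j. (w i j)\<^sup>2)" for i j
  proof -
    have "(gsum N (\<lambda>k l. a k l * w (i - k) (j - l)))\<^sup>2
        \<le> gsum N (\<lambda>k l. (a k l)\<^sup>2) * gsum N (\<lambda>k l. (w (i - k) (j - l))\<^sup>2)"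
      by (rule gsum_Cauchy_Schwarz)
    also have "gsum N (\<lambda>k l. (w (i - k) (j - l))\<^sup>2) = gsum N (\<lambda>i j. (w i j)\<^sup>2)"
      using gsum_reflect[OF Cper_pointwise[OF w, of "\<lambda>x. x\<^sup>2"]] .
    finally show ?thesis
      using mult_right_mono[OF A gsum_nonneg[of "\<lambda>i j. (w i j)\<^sup>2" N]] by simp
  qed
  then have "gsum N (\<lambda>i j. (gsum N (\<lambda>k l. a k l * w (i - k) (j - l)))\<^sup>2)
      \<le> gsum N (\<lambda>i j. (real N)\<^sup>2 * A\<^sup>2 * gsum N (\<lambda>i j. (w i j)\<^sup>2))"
    by (rule gsum_mono)
  also have "\<dots> = A\<^sup>2 * real N ^ 4 * gsum N (\<lambda>i j. (w i j)\<^sup>2)"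
    by (simp add: gsum_const power4_eq_xxxx power2_eq_square)
  finally show ?thesis .
qed

text \<open>Reindexing moves the shift from \<open>f\<close> onto the kernel. Differences of a
  convolution thus become differences of \<open>J\<close>, and no difference of \<open>f\<close> is
  ever taken.\<close>

lemma conv_shift:
  assumes "grid_kernel L N J \<in> Cper N" "f \<in> Cper N"
  shows "conv L N J f (i + a) (j + b)
    = (mesh L N)\<^sup>2 * gsum N (\<lambda>k l. grid_kernel L N J (k + a) (l + b) * f (i - k) (j - l))"
  using gsum_shift[OF Cper_pointwise2[OF assms(1) Cper_reflect[OF assms(2)], of times], of a b "i + a" "j + b"]
  by (simp add: conv_grid_kernel)

text \<open>Lipschitz continuity along each coordinate separately, which is what one-cell
  differences of the sampled kernel require. In the second inequality \<open>y\<close> is the first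
  coordinate.\<close>

definition lipschitz_on_box :: "real \<Rightarrow> real \<Rightarrow> (real \<times> real \<Rightarrow> real) \<Rightarrow> bool" where
  "lipschitz_on_box M R J \<longleftrightarrow>
     (\<forall>x x' y. 0 \<le> x \<and> x \<le> x' \<and> x' \<le> R \<and> 0 \<le> y \<and> y \<le> R \<longrightarrow>
       \<bar>J (x', y) - J (x, y)\<bar> \<le> M * (x' - x) \<and> \<bar>J (y, x') - J (y, x)\<bar> \<le> M * (x' - x))"

lemma grid_norm_sq: "(grid_norm L N f)\<^sup>2 = (mesh L N)\<^sup>2 * gsum N (\<lambda>i j. (f i j)\<^sup>2)"
  by (simp add: grid_norm_def grid_inner_gsum power2_eq_square gsum_nonneg)

text \<open>One-cell differences of the kernel are at most \<open>M * h\<close>, and the gain of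
  \<open>h\<close> is exactly what a gradient bound independent of the mesh needs. The factor 2
  counts the two coordinate directions.\<close>

lemma dirichlet_form_conv_le:
  assumes L: "L > 0" "N \<ge> 1" and J: "grid_kernel L N J \<in> Cper N" and w: "w \<in> Cper N"
    and lip: "lipschitz_on_box M (2 * L) J"
  shows "dirichlet_form N (conv L N J w) (conv L N J w) \<le> 2 * M\<^sup>2 * L ^ 4 * (grid_norm L N w)\<^sup>2"
proof -
  let ?h = "mesh L N" and ?J = "grid_kernel L N J"
  have h: "?h > 0" and NhL: "real N * ?h = L" using mesh_pos[OF L] L by (auto simp: mesh_def)
  \<comment> \<open>The differences also sample the kernel at index \<open>N + 1\<close>. Since
    \<open>N + 1\<close> is at most \<open>2 * N\<close>, all points stay in the box of side
    \<open>2 * L\<close>.\<close>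
  have range: "0 \<le> of_int k * ?h" "of_int k * ?h \<le> of_int (k + 1) * ?h"
      "of_int (k + 1) * ?h \<le> 2 * L" if "k \<in> {1..int N}" for k
  proof -
    show "0 \<le> of_int k * ?h" using that h by simp
    show "of_int k * ?h \<le> of_int (k + 1) * ?h" using h by simp
    have "(of_int (k + 1) :: real) \<le> of_int (2 * int N)" using that L by (subst of_int_le_iff) auto
    then have "of_int (k + 1) * ?h \<le> of_int (2 * int N) * ?h" using h by (intro mult_right_mono) auto
    then show "of_int (k + 1) * ?h \<le> 2 * L" using NhL by simp
  qed
  have diff: "\<bar>?J (k + 1) l - ?J k l\<bar> \<le> M * ?h" "\<bar>?J k (l + 1) - ?J k l\<bar> \<le> M * ?h"
    if "k \<in> {1..int N}" "l \<in> {1..int N}" for k l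
  proof -
    have step: "of_int (k + 1) * ?h - of_int k * ?h = ?h" for k by (simp add: algebra_simps)
    show "\<bar>?J (k + 1) l - ?J k l\<bar> \<le> M * ?h" "\<bar>?J k (l + 1) - ?J k l\<bar> \<le> M * ?h"
      using lip[unfolded lipschitz_on_box_def, rule_format,
          of "of_int k * ?h" "of_int (k + 1) * ?h" "of_int l * ?h"]
        lip[unfolded lipschitz_on_box_def, rule_format,
          of "of_int l * ?h" "of_int (l + 1) * ?h" "of_int k * ?h"]
        range[OF that(1)] range[OF that(2)] unfolding grid_kernel_def step by linarith+
  qed
  let ?W = "gsum N (\<lambda>i j. (w i j)\<^sup>2)"
  have part: "gsum N (\<lambda>i j. (conv L N J w (i + a) (j + b) - conv L N J w i j)\<^sup>2)
      \<le> M\<^sup>2 * L ^ 4 * (?h\<^sup>2 * ?W)"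
    if ab: "\<And>k l. k \<in> {1..int N} \<Longrightarrow> l \<in> {1..int N} \<Longrightarrow> \<bar>?J (k + a) (l + b) - ?J k l\<bar> \<le> M * ?h" for a b
  proof -
    have "conv L N J w (i + a) (j + b) - conv L N J w i j =
        ?h\<^sup>2 * gsum N (\<lambda>k l. (?J (k + a) (l + b) - ?J k l) * w (i - k) (j - l))" for i j
      unfolding conv_shift[OF J w] by (simp add: conv_grid_kernel left_diff_distrib gsum_diff right_diff_distrib)
    then have "gsum N (\<lambda>i j. (conv L N J w (i + a) (j + b) - conv L N J w i j)\<^sup>2)
        = ?h ^ 4 * gsum N (\<lambda>i j. (gsum N (\<lambda>k l. (?J (k + a) (l + b) - ?J k l) * w (i - k) (j - l)))\<^sup>2)"
      by (simp add: power_mult_distrib gsum_cmult)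
    \<comment> \<open>The factor \<open>?h ^ 4\<close> combines with \<open>N ^ 4\<close> into
      \<open>L ^ 4\<close>. The \<open>h^2\<close> from the squared Lipschitz bound remains and
      serves as the weight of the grid norm.\<close>
    also have "\<dots> \<le> ?h ^ 4 * ((M * ?h)\<^sup>2 * real N ^ 4 * ?W)"
      using h by (intro mult_left_mono gsum_conv_sq_le[OF w] ab) auto
    also have "\<dots> = M\<^sup>2 * (real N * ?h) ^ 4 * (?h\<^sup>2 * ?W)"
      by (simp add: power_mult_distrib)
    finally show ?thesis unfolding NhL .
  qed
  have "dirichlet_form N (conv L N J w) (conv L N J w) =
      gsum N (\<lambda>i j. (conv L N J w (i + 1) (j + 0) - conv L N J w i j)\<^sup>2)
    + gsum N (\<lambda>i j. (conv L N J w (i + 0) (j + 1) - conv L N J w i j)\<^sup>2)"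
    unfolding dirichlet_form_def gsum_add[symmetric] by (simp add: power2_eq_square)
  also have "\<dots> \<le> 2 * (M\<^sup>2 * L ^ 4 * (?h\<^sup>2 * ?W))"
    using part[of 1 0] part[of 0 1] diff by simp
  also have "?h\<^sup>2 * ?W = (grid_norm L N w)\<^sup>2"
    by (simp add: grid_norm_sq)
  finally show ?thesis by simp
qed

text \<open>Termwise from \<open>(\<theta> * x - y)^2 / (2 * \<theta>)\<close> being
  nonnegative.\<close>

lemma dirichlet_form_Young:
  assumes "\<theta> > 0"
  shows "dirichlet_form N f g \<le> \<theta> / 2 * dirichlet_form N f f + dirichlet_form N g g / (2 * \<theta>)"
proof -
  have Y: "x * y \<le> \<theta> / 2 * (x * x) + (y * y) / (2 * \<theta>)" for x y :: real
  proof -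
    have "0 \<le> (\<theta> * x - y)\<^sup>2 / (2 * \<theta>)" using assms by simp
    also have "\<dots> = \<theta> / 2 * (x * x) + (y * y) / (2 * \<theta>) - x * y"
      using assms by (simp add: field_simps power2_eq_square)
    finally show ?thesis by simp
  qed
  have "x * y + x' * y' \<le> \<theta> / 2 * (x * x + x' * x') + (y * y + y' * y') / (2 * \<theta>)" for x y x' y' :: real
    using add_mono[OF Y[of x y] Y[of x' y']] by (simp add: distrib_left add_divide_distrib)
  then show ?thesis
    unfolding dirichlet_form_def gsum_cmult[symmetric] gsum_divide[symmetric] gsum_add[symmetric]
    by (intro gsum_mono)
qed

text \<open>The two partial derivatives are continuous, hence bounded on the compact square, and the
  mean value theorem along coordinate lines turns these bounds into Lipschitz bounds. Continuity is
  given for each direction separately, so \<open>M\<close> is the maximum of the bounds for the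
  directions \<open>(1, 0)\<close> and \<open>(0, 1)\<close>.\<close>

lemma k_smooth_1_lipschitz_on_box:
  assumes "k_smooth 1 J" and R: "R \<ge> 0"
  obtains M where "M > 0" "lipschitz_on_box M R J"
proof -
  let ?D = "\<lambda>v x. frechet_derivative J (at x) v"
  have diff: "(J has_derivative frechet_derivative J (at x)) (at x)" for x
    unfolding frechet_derivative_works[symmetric] using assms(1) by (cases x) simp
  have cont: "continuous_on UNIV (?D v)" for v
    using assms(1) by (cases v) simp
  have "\<exists>B>0. \<forall>x\<in>cbox (0, 0) (R, R). \<bar>?D v x\<bar> \<le> B" for v
  proof -
    have "compact (?D v ` cbox (0, 0) (R, R))"
      by (intro compact_continuous_image continuous_on_subset[OF cont] compact_cbox) auto
    from compact_imp_bounded[OF this] show ?thesis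
      by (auto simp: bounded_pos)
  qed
  then obtain B where B: "\<And>v. B v > 0" "\<And>v x. x \<in> cbox (0, 0) (R, R) \<Longrightarrow> \<bar>?D v x\<bar> \<le> B v"
    by metis
  define M where "M = max (B (1, 0)) (B (0, 1))"
  have dx: "((\<lambda>s. J (s, y)) has_real_derivative ?D (1, 0) (s, y)) (at s)" for s y
  proof -
    have "((\<lambda>s. J (s, y)) has_derivative (\<lambda>t. ?D (t, 0) (s, y))) (at s)"
      using has_derivative_compose[OF has_derivative_Pair[OF has_derivative_ident has_derivative_const] diff] .
    moreover have "(\<lambda>t. ?D (t, 0) (s, y)) = (*) (?D (1, 0) (s, y))"
    proof
      fix t
      show "?D (t, 0) (s, y) = ?D (1, 0) (s, y) * t"
        using linear_scale[OF has_derivative_linear[OF diff], of "(s, y)" t "(1, 0)"]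
        by (simp only: scaleR_Pair real_scaleR_def mult_1_right mult_zero_right
            mult_1_left mult_zero_left mult.commute)
    qed
    ultimately show ?thesis by (simp only: has_field_derivative_def)
  qed
  have dy: "((\<lambda>s. J (y, s)) has_real_derivative ?D (0, 1) (y, s)) (at s)" for s y
  proof -
    have "((\<lambda>s. J (y, s)) has_derivative (\<lambda>t. ?D (0, t) (y, s))) (at s)"
      using has_derivative_compose[OF has_derivative_Pair[OF has_derivative_const has_derivative_ident] diff] .
    moreover have "(\<lambda>t. ?D (0, t) (y, s)) = (*) (?D (0, 1) (y, s))"
    proof
      fix t
      show "?D (0, t) (y, s) = ?D (0, 1) (y, s) * t"
        using linear_scale[OF has_derivative_linear[OF diff], of "(y, s)" t "(0, 1)"]
        by (simp only: scaleR_Pair real_scaleR_def mult_1_right mult_zero_right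
            mult_1_left mult_zero_left mult.commute)
    qed
    ultimately show ?thesis by (simp only: has_field_derivative_def)
  qed
  have mvt: "\<bar>f b - f a\<bar> \<le> M * (b - a)"
    if "\<And>s. (f has_real_derivative f' s) (at s)" "\<And>s. a \<le> s \<Longrightarrow> s \<le> b \<Longrightarrow> \<bar>f' s\<bar> \<le> M" "a \<le> b"
    for f f' :: "real \<Rightarrow> real" and a b
  proof (cases "a = b")
    case False
    with that(3) have "a < b" by simp
    with MVT2[of a b f f'] that(1) obtain z where "a < z" "z < b" "f b - f a = (b - a) * f' z"
      by blast
    then show ?thesis using that(2)[of z] that(3) by (simp add: abs_mult mult_right_mono mult.commute)
  qed simp
  have "lipschitz_on_box M R J"
    unfolding lipschitz_on_box_def
  proof (intro allI impI conjI; elim conjE)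
    fix x x' y assume *: "0 \<le> x" "x \<le> x'" "x' \<le> R" "0 \<le> y" "y \<le> R"
    show "\<bar>J (x', y) - J (x, y)\<bar> \<le> M * (x' - x)"
      by (rule mvt[OF dx]) (use * B(2)[of "(_, y)" "(1, 0)"] in \<open>auto simp: M_def le_max_iff_disj\<close>)
    show "\<bar>J (y, x') - J (y, x)\<bar> \<le> M * (x' - x)"
      by (rule mvt[OF dy]) (use * B(2)[of "(y, _)" "(0, 1)"] in \<open>auto simp: M_def le_max_iff_disj\<close>)
  qed
  moreover have "M > 0" using B(1) by (simp add: M_def less_max_iff_disj)
  ultimately show ?thesis using that by blast
qed


section \<open>The modified potential\<close>

text \<open>Away from 0 the function agrees locally with a power or with 0. At 0 the exponent is at
  least 2, so the difference quotient is still a positive power of the positive part and tends to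
  0.\<close>

lemma has_real_derivative_pos_part_power:
  "((\<lambda>x. max 0 x ^ Suc (Suc n)) has_real_derivative real (Suc (Suc n)) * max 0 x ^ Suc n) (at x)"
    for x :: real
proof -
  consider "x > 0" | "x < 0" | "x = 0" by linarith
  then show ?thesis
  proof cases
    case 1
    have "((\<lambda>x. x ^ Suc (Suc n)) has_real_derivative real (Suc (Suc n)) * x ^ Suc n) (at x)"
      by (rule derivative_eq_intros refl)+ simp
    then have "((\<lambda>x. max 0 x ^ Suc (Suc n)) has_real_derivative real (Suc (Suc n)) * x ^ Suc n) (at x)"
      by (rule has_field_derivative_transform_within_open[of _ _ _ "{0<..}"]) (use 1 in auto)
    then show ?thesis using 1 by simp
  next
    case 2
    have "((\<lambda>x. max 0 x ^ Suc (Suc n)) has_real_derivative 0) (at x)"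
      by (rule has_field_derivative_transform_within_open[of "\<lambda>_. 0" _ _ "{..<0}"]) (use 2 in auto)
    then show ?thesis using 2 by simp
  next
    case 3
    have "max 0 h ^ Suc (Suc n) / h = max 0 h ^ Suc n" for h :: real
      by (cases "h = 0") (auto simp: max_def)
    moreover have "(\<lambda>h::real. max 0 h ^ Suc n) \<midarrow>0\<rightarrow> max 0 0 ^ Suc n"
      by (intro tendsto_intros)
    ultimately show ?thesis using 3 by (simp add: DERIV_def)
  qed
qed

lemma has_real_derivative_pos_part_power_chain:
  assumes "(f has_real_derivative f') (at x)"
  shows "((\<lambda>x. max 0 (f x) ^ 2) has_real_derivative 2 * max 0 (f x) * f') (at x)"
    "((\<lambda>x. max 0 (f x) ^ 3) has_real_derivative 3 * max 0 (f x) ^ 2 * f') (at x)"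
    "((\<lambda>x. max 0 (f x) ^ 4) has_real_derivative 4 * max 0 (f x) ^ 3 * f') (at x)"
  using DERIV_chain2[OF has_real_derivative_pos_part_power[of 0] assms]
    DERIV_chain2[OF has_real_derivative_pos_part_power[of 1] assms]
    DERIV_chain2[OF has_real_derivative_pos_part_power[of 2] assms]
  by (simp_all add: numeral_eq_Suc)

text \<open>Subtracting powers at least 3 of positive parts makes the \<open>C\<^sup>2\<close> matching at \<open>\<plusminus>K\<close> automatic.\<close>

lemma FK_pos_part:
  assumes "K > 0"
  shows "FK K = (\<lambda>u. (u\<^sup>2 - 1)\<^sup>2 / 4 - K * max 0 (u - K) ^ 3 - max 0 (u - K) ^ 4 / 4
    - K * max 0 (- u - K) ^ 3 - max 0 (- u - K) ^ 4 / 4)"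
proof
  fix u
  consider "\<bar>u\<bar> \<le> K" | "u > K" | "u < - K" by linarith
  then show "FK K u = (u\<^sup>2 - 1)\<^sup>2 / 4 - K * max 0 (u - K) ^ 3 - max 0 (u - K) ^ 4 / 4
    - K * max 0 (- u - K) ^ 3 - max 0 (- u - K) ^ 4 / 4"
  proof cases
    case 1
    then have "max 0 (u - K) = 0" "max 0 (- u - K) = 0" by auto
    then show ?thesis using 1 by (simp add: FK_def)
  next
    case 2
    then have "max 0 (u - K) = u - K" "max 0 (- u - K) = 0" "\<not> \<bar>u\<bar> \<le> K" using assms by auto
    then show ?thesis using 2 by (simp add: FK_def field_simps power2_eq_square power3_eq_cube power4_eq_xxxx)
  next
    case 3
    then have "max 0 (u - K) = 0" "max 0 (- u - K) = - u - K" "\<not> \<bar>u\<bar> \<le> K" "\<not> u > K" using assms by auto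
    then show ?thesis using 3 by (simp add: FK_def field_simps power2_eq_square power3_eq_cube power4_eq_xxxx)
  qed
qed

text \<open>This certifies that the \<open>deriv\<close> terms in the scheme and in the bound by
  \<open>\<beta>\<close> are true derivatives. The positive parts enter with powers at least 3, so
  two differentiations leave powers at least 1.\<close>

lemma FK_twice_differentiable:
  assumes "K > 0"
  shows "(FK K has_real_derivative deriv (FK K) u) (at u)"
    and "(deriv (FK K) has_real_derivative deriv (deriv (FK K)) u) (at u)"
proof -
  let ?d = "\<lambda>u. u * (u\<^sup>2 - 1) - 3 * K * max 0 (u - K) ^ 2 - max 0 (u - K) ^ 3
    + 3 * K * max 0 (- u - K) ^ 2 + max 0 (- u - K) ^ 3"
  have d: "(FK K has_real_derivative ?d u) (at u)" for u
    unfolding FK_pos_part[OF assms]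
    by (rule has_real_derivative_pos_part_power_chain derivative_eq_intros refl
        zero_neq_numeral[symmetric])+
      (simp add: field_simps)
  then have deriv: "deriv (FK K) = ?d" by (intro ext DERIV_imp_deriv)
  then show "(FK K has_real_derivative deriv (FK K) u) (at u)" using d by simp
  have "(?d has_real_derivative 3 * u\<^sup>2 - 1 - 6 * K * max 0 (u - K) - 3 * max 0 (u - K) ^ 2
      - 6 * K * max 0 (- u - K) - 3 * max 0 (- u - K) ^ 2) (at u)"
    by (rule has_real_derivative_pos_part_power_chain derivative_eq_intros refl)+
      (simp add: algebra_simps power2_eq_square)
  then show "(deriv (FK K) has_real_derivative deriv (deriv (FK K)) u) (at u)"
    unfolding deriv[symmetric] using DERIV_imp_deriv by metis
qed

section \<open>Consequences of the bound on the second derivative\<close>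

lemma Taylor_second_order_le:
  fixes f :: "real \<Rightarrow> real"
  assumes d1: "\<And>x. (f has_real_derivative f' x) (at x)" and d2: "\<And>x. (f' has_real_derivative f'' x) (at x)"
    and bound: "\<And>x. \<bar>f'' x\<bar> \<le> B"
  shows "f y - f x \<le> f' x * (y - x) + B / 2 * (y - x)\<^sup>2"
proof (cases "y = x")
  case False
  define diff where "diff = (\<lambda>n::nat. if n = 0 then f else if n = 1 then f' else f'')"
  have "\<exists>t. (if y < x then y < t \<and> t < x else x < t \<and> t < y) \<and>
      f y = (\<Sum>m<2. diff m x / fact m * (y - x) ^ m) + diff 2 t / fact 2 * (y - x) ^ 2"
    by (rule Taylor[of 2 diff f "min x y" "max x y" x y])
      (use False d1 d2 in \<open>auto simp: diff_def less_2_cases_iff\<close>)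
  then obtain t where "f y = f x + f' x * (y - x) + f'' t / 2 * (y - x)\<^sup>2"
    by (auto simp: diff_def numeral_2_eq_2)
  moreover have "f'' t / 2 * (y - x)\<^sup>2 \<le> B / 2 * (y - x)\<^sup>2"
    using bound[of t] by (intro mult_right_mono) auto
  ultimately show ?thesis by linarith
qed simp

lemma abs_diff_le_of_deriv_bound:
  fixes f :: "real \<Rightarrow> real"
  assumes "\<And>x. (f has_real_derivative f' x) (at x)" and "\<And>x. \<bar>f' x\<bar> \<le> B"
  shows "\<bar>f y - f x\<bar> \<le> B * \<bar>y - x\<bar>"
  using field_differentiable_bound[of UNIV f f' B y x] assms by simp

text \<open>With \<open>g\<close> the derivative of \<open>FK K\<close>, split
  \<open>2 g(b) - g(a)\<close> as \<open>g(b) + (g(b) - g(a))\<close>. Taylor expansion at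
  \<open>b\<close> costs \<open>\<beta>/2 (c - b)^2\<close>. The Lipschitz bound for
  \<open>g\<close> and the arithmetic-geometric mean inequality cost a further
  \<open>\<beta>/2 ((b - a)^2 + (c - b)^2)\<close>.\<close>

lemma extrapolated_FK_deriv_ge:
  assumes K: "K > 0" and \<beta>: "\<And>s. \<bar>deriv (deriv (FK K)) s\<bar> \<le> \<beta>"
  shows "FK K c - FK K b - \<beta> * (c - b)\<^sup>2 - \<beta> / 2 * (b - a)\<^sup>2
    \<le> (2 * deriv (FK K) b - deriv (FK K) a) * (c - b)"
proof -
  let ?g = "deriv (FK K)"
  have "\<beta> \<ge> 0" using \<beta>[of 0] by linarith
  have "\<bar>?g b - ?g a\<bar> * \<bar>c - b\<bar> \<le> \<beta> * \<bar>b - a\<bar> * \<bar>c - b\<bar>"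
    using abs_diff_le_of_deriv_bound[OF FK_twice_differentiable(2)[OF K] \<beta>] by (intro mult_right_mono) auto
  also have "\<dots> \<le> \<beta> * (((b - a)\<^sup>2 + (c - b)\<^sup>2) / 2)"
    using sum_squares_bound[of "\<bar>b - a\<bar>" "\<bar>c - b\<bar>"] \<open>\<beta> \<ge> 0\<close>
    by (simp only: mult.assoc power2_abs, intro mult_left_mono) auto
  finally have "\<bar>(?g b - ?g a) * (c - b)\<bar> \<le> \<beta> * (((b - a)\<^sup>2 + (c - b)\<^sup>2) / 2)"
    by (simp only: abs_mult)
  then have "- (\<beta> * (((b - a)\<^sup>2 + (c - b)\<^sup>2) / 2)) \<le> (?g b - ?g a) * (c - b)"
    by linarith
  moreover have "FK K c - FK K b \<le> ?g b * (c - b) + \<beta> / 2 * (c - b)\<^sup>2"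
    by (rule Taylor_second_order_le[OF FK_twice_differentiable[OF K] \<beta>])
  moreover have "(2 * ?g b - ?g a) * (c - b) = ?g b * (c - b) + (?g b - ?g a) * (c - b)"
    by (simp add: algebra_simps)
  ultimately show ?thesis by (simp add: field_simps)
qed


section \<open>Energy dissipation\<close>

text \<open>One step of the scheme, with \<open>a\<close>, \<open>b\<close>, \<open>c\<close> the
  levels \<open>n - 1\<close>, \<open>n\<close>, \<open>n + 1\<close>. The time step bound is the
  one of the theorem with \<open>M^2 L^4 / 2\<close> inserted for the kernel constant.\<close>

lemma scheme_step_energy_le:
  fixes a b c :: grid_fun
  assumes L: "L > 0" "N \<ge> 1" and per: "grid_kernel L N J \<in> Cper N" and even: "\<And>x. J (- x) = J x"
    and lip: "lipschitz_on_box M (2 * L) J" and M: "M > 0" and \<epsilon>: "\<epsilon> > 0" and K: "K > 0"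
    and \<beta>: "\<And>s. \<bar>deriv (deriv (FK K)) s\<bar> \<le> \<beta>"
    and \<tau>: "\<tau> > 0" "\<tau> \<le> 4 * (\<epsilon>\<^sup>2 * conv_one L N J - 3 * \<beta>) / (M\<^sup>2 * L ^ 4 * \<epsilon> ^ 4)"
    and Cper: "a \<in> Cper N" "b \<in> Cper N" "c \<in> Cper N"
    and v: "(\<lambda>i j. b i j - a i j) \<in> zero_mean N" and w: "(\<lambda>i j. c i j - b i j) \<in> zero_mean N"
    and step: "\<And>i j. (3 * c i j - 4 * b i j + a i j) / (2 * \<tau>) = lap L N (chem_pot L N J \<epsilon> K c b a) i j"
  shows "mod_energy L N J \<epsilon> K \<beta> \<tau> c (\<lambda>i j. c i j - b i j)
    \<le> mod_energy L N J \<epsilon> K \<beta> \<tau> b (\<lambda>i j. b i j - a i j)"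
proof -
  define v where "v = (\<lambda>i j. b i j - a i j)"
  define w where "w = (\<lambda>i j. c i j - b i j)"
  define \<phi> where "\<phi> = inv_neg_lap L N w"
  define \<psi> where "\<psi> = inv_neg_lap L N v"
  define \<omega> where "\<omega> = chem_pot L N J \<epsilon> K c b a"
  let ?h = "mesh L N" and ?I = "grid_inner N" and ?C = "conv L N J" and ?J1 = "conv_one L N J"
  have vz: "v \<in> zero_mean N" and wz: "w \<in> zero_mean N" using v w by (simp_all add: v_def w_def)
  have wp: "w \<in> Cper N" using wz by (simp add: zero_mean_def)
  have \<phi>p: "\<phi> \<in> Cper N" and \<phi>: "neg_lap L N \<phi> = w"
    using inv_neg_lap_zero_mean[OF L wz] neg_lap_inv_neg_lap[OF L wz]
    by (simp_all add: \<phi>_def zero_mean_def)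
  have \<psi>p: "\<psi> \<in> Cper N" and \<psi>: "neg_lap L N \<psi> = v"
    using inv_neg_lap_zero_mean[OF L vz] neg_lap_inv_neg_lap[OF L vz]
    by (simp_all add: \<psi>_def zero_mean_def)
  have \<omega>p: "\<omega> \<in> Cper N"
    using Cper Cper_conv[OF Cper(3), of L J] by (simp add: \<omega>_def chem_pot_def Cper_def)
  have comm: "?I f g = ?I g f" for f g by (simp add: grid_inner_gsum mult.commute)
  define A where "A = dirichlet_form N \<phi> \<phi>"
  define B where "B = dirichlet_form N \<psi> \<psi>"
  define W where "W = (grid_norm L N w)\<^sup>2"
  define V where "V = (grid_norm L N v)\<^sup>2"
  have nonneg: "A \<ge> 0" "W \<ge> 0" by (simp_all add: A_def W_def dirichlet_form_nonneg)

  have upper: "?h\<^sup>2 * ?I w \<omega> \<le> (B - 5 * A) / (4 * \<tau>)"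
  proof -
    \<comment> \<open>\<open>3c - 4b + a = 3w - v\<close>, so the scheme expresses the Laplacian of
      the chemical potential through the two increments. Testing with the potential
      \<open>\<phi>\<close> of \<open>w\<close> then recovers the pairing of \<open>w\<close> with
      \<open>\<omega>\<close>.\<close>
    have "neg_lap L N \<omega> = (\<lambda>i j. (v i j - 3 * w i j) / (2 * \<tau>))"
      unfolding neg_lap_def \<omega>_def step[symmetric] v_def w_def minus_divide_left
      by (simp add: algebra_simps)
    then have "?I \<phi> (neg_lap L N \<omega>) = (?I \<phi> v - 3 * ?I \<phi> w) / (2 * \<tau>)"
      by (simp add: grid_inner_gsum right_diff_distrib mult.left_commute[of _ 3] gsum_linear)
    then have "?h\<^sup>2 * ?I w \<omega> = (?h\<^sup>2 * ?I \<phi> v - 3 * (?h\<^sup>2 * ?I \<phi> w)) / (2 * \<tau>)"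
      using neg_lap_self_adjoint[OF L \<phi>p \<omega>p] by (simp add: \<phi> algebra_simps)
    also have "?h\<^sup>2 * ?I \<phi> v = dirichlet_form N \<phi> \<psi>"
      using summation_by_parts[OF L \<phi>p \<psi>p] by (simp add: \<psi>)
    also have "?h\<^sup>2 * ?I \<phi> w = A"
      using summation_by_parts[OF L \<phi>p \<phi>p] by (simp add: \<phi> A_def)
    also have "(dirichlet_form N \<phi> \<psi> - 3 * A) / (2 * \<tau>) \<le> (A / 2 + B / 2 - 3 * A) / (2 * \<tau>)"
      using dirichlet_form_Young[of 1 N \<phi> \<psi>] \<tau>(1)
      by (intro divide_right_mono) (auto simp: A_def B_def)
    also have "\<dots> = (B - 5 * A) / (4 * \<tau>)" using \<tau>(1) by (simp add: field_simps)
    finally show ?thesis .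
  qed

  have lower: "energy L N J \<epsilon> K c - energy L N J \<epsilon> K b \<le>
      ?h\<^sup>2 * ?I w \<omega> + \<beta> * W + \<beta> / 2 * V - \<epsilon>\<^sup>2 * ?J1 / 2 * W + \<epsilon>\<^sup>2 / 2 * (?h\<^sup>2 * ?I w (?C w))"
  proof -
    have nonlin: "?h\<^sup>2 * gsum N (\<lambda>i j. FK K (c i j)) - ?h\<^sup>2 * gsum N (\<lambda>i j. FK K (b i j)) - \<beta> * W - \<beta> / 2 * V
        \<le> ?h\<^sup>2 * gsum N (\<lambda>i j. (2 * deriv (FK K) (b i j) - deriv (FK K) (a i j)) * w i j)"
    proof -
      have "gsum N (\<lambda>i j. FK K (c i j) - FK K (b i j) - \<beta> * (w i j)\<^sup>2 - \<beta> / 2 * (v i j)\<^sup>2)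
          \<le> gsum N (\<lambda>i j. (2 * deriv (FK K) (b i j) - deriv (FK K) (a i j)) * w i j)"
        unfolding v_def w_def by (intro gsum_mono extrapolated_FK_deriv_ge[OF K \<beta>])
      then have "?h\<^sup>2 * (gsum N (\<lambda>i j. FK K (c i j)) - gsum N (\<lambda>i j. FK K (b i j))
            - \<beta> * gsum N (\<lambda>i j. (w i j)\<^sup>2) - \<beta> / 2 * gsum N (\<lambda>i j. (v i j)\<^sup>2))
          \<le> ?h\<^sup>2 * gsum N (\<lambda>i j. (2 * deriv (FK K) (b i j) - deriv (FK K) (a i j)) * w i j)"
        unfolding gsum_diff gsum_cmult by (intro mult_left_mono) auto
      then show ?thesis by (simp add: W_def V_def grid_norm_sq algebra_simps)
    qed
    have \<omega>_split: "?I w \<omega> = gsum N (\<lambda>i j. (2 * deriv (FK K) (b i j) - deriv (FK K) (a i j)) * w i j)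
        + \<epsilon>\<^sup>2 * ?J1 * gsum N (\<lambda>i j. c i j * w i j) - \<epsilon>\<^sup>2 * ?I w (?C c)"
      unfolding grid_inner_gsum gsum_diff[symmetric] gsum_add[symmetric] gsum_cmult[symmetric]
      by (simp add: \<omega>_def chem_pot_def algebra_simps)
    \<comment> \<open>Polarization \<open>c^2 - b^2 = 2 c w - w^2\<close>. The new level
      \<open>c\<close> appears in the cross term because the scheme treats this part implicitly; the
      remaining square of \<open>w\<close> is numerical dissipation.\<close>
    have quad: "(grid_norm L N c)\<^sup>2 - (grid_norm L N b)\<^sup>2 = 2 * (?h\<^sup>2 * gsum N (\<lambda>i j. c i j * w i j)) - W"
    proof -
      have "gsum N (\<lambda>i j. (c i j)\<^sup>2) - gsum N (\<lambda>i j. (b i j)\<^sup>2) =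
          2 * gsum N (\<lambda>i j. c i j * w i j) - gsum N (\<lambda>i j. (w i j)\<^sup>2)"
        unfolding gsum_diff[symmetric] gsum_cmult[symmetric]
        by (simp add: w_def power2_eq_square algebra_simps)
      then have "?h\<^sup>2 * (gsum N (\<lambda>i j. (c i j)\<^sup>2) - gsum N (\<lambda>i j. (b i j)\<^sup>2)) =
          ?h\<^sup>2 * (2 * gsum N (\<lambda>i j. c i j * w i j) - gsum N (\<lambda>i j. (w i j)\<^sup>2))"
        by simp
      then show ?thesis by (simp add: grid_norm_sq W_def algebra_simps)
    qed
    have conv: "?I c (?C c) - ?I b (?C b) = 2 * ?I w (?C c) - ?I w (?C w)"
    proof -
      have c: "c = (\<lambda>i j. b i j + w i j)" by (simp add: w_def)
      have add: "?I (\<lambda>i j. f i j + g i j) k = ?I f k + ?I g k"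
        "?I k (\<lambda>i j. f i j + g i j) = ?I k f + ?I k g" for f g k
        by (simp_all add: grid_inner_gsum algebra_simps gsum_add)
      have "?I b (?C w) = ?I w (?C b)"
        using conv_self_adjoint[OF Cper(2) wp per even] comm by metis
      then show ?thesis unfolding c conv_add add by simp
    qed
    have "energy L N J \<epsilon> K c - energy L N J \<epsilon> K b =
        ?h\<^sup>2 * gsum N (\<lambda>i j. FK K (c i j)) - ?h\<^sup>2 * gsum N (\<lambda>i j. FK K (b i j))
        + \<epsilon>\<^sup>2 * ?J1 / 2 * ((grid_norm L N c)\<^sup>2 - (grid_norm L N b)\<^sup>2)
        - \<epsilon>\<^sup>2 / 2 * ?h\<^sup>2 * (?I c (?C c) - ?I b (?C b))"
      by (simp add: energy_def grid_inner_grid_one algebra_simps diff_divide_distrib)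
    also have "\<dots> = ?h\<^sup>2 * gsum N (\<lambda>i j. FK K (c i j)) - ?h\<^sup>2 * gsum N (\<lambda>i j. FK K (b i j))
        + ?h\<^sup>2 * (?I w \<omega> - gsum N (\<lambda>i j. (2 * deriv (FK K) (b i j) - deriv (FK K) (a i j)) * w i j))
        - \<epsilon>\<^sup>2 * ?J1 / 2 * W + \<epsilon>\<^sup>2 / 2 * (?h\<^sup>2 * ?I w (?C w))"
      unfolding quad conv \<omega>_split by (simp add: field_simps)
    finally show ?thesis using nonlin by (simp add: right_diff_distrib)
  qed

  define D where "D = \<epsilon>\<^sup>2 * ?J1 - 3 * \<beta>"
  have pos: "M\<^sup>2 * L ^ 4 * \<epsilon> ^ 4 > 0" using M L \<epsilon> by simp
  \<comment> \<open>A positive \<open>\<tau>\<close> below the bound forces the bound, and hence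
    \<open>D\<close>, to be strictly positive, so \<open>\<theta>\<close> can serve as a Young
    parameter.\<close>
  have "0 < 4 * D / (M\<^sup>2 * L ^ 4 * \<epsilon> ^ 4)" using \<tau> unfolding D_def by linarith
  then have D: "D > 0" using pos by (simp add: zero_less_divide_iff)
  \<comment> \<open>The Young parameter for which the convolution term exactly exhausts the available multiple of \<open>W\<close>.\<close>
  define \<theta> where "\<theta> = D / (\<epsilon>\<^sup>2 * M\<^sup>2 * L ^ 4)"
  have \<theta>: "\<theta> > 0" using D M L \<epsilon> by (simp add: \<theta>_def)
  \<comment> \<open>Since \<open>w\<close> is minus the Laplacian of \<open>\<phi>\<close>,
    summation by parts puts one difference on the convolution, where the kernel absorbs it, and the
    other on \<open>\<phi>\<close>, where it is controlled by the dual norm of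
    \<open>w\<close>.\<close>
  have "?h\<^sup>2 * ?I w (?C w) = dirichlet_form N (?C w) \<phi>"
    using summation_by_parts[OF L Cper_conv[OF wp, of L J] \<phi>p] comm by (simp add: \<phi>)
  also have "\<dots> \<le> \<theta> / 2 * (2 * M\<^sup>2 * L ^ 4 * W) + A / (2 * \<theta>)"
    using dirichlet_form_Young[OF \<theta>, of N "?C w" \<phi>] \<theta>
      mult_left_mono[OF dirichlet_form_conv_le[OF L per wp lip], of "\<theta> / 2"]
    unfolding A_def W_def by linarith
  finally have "\<epsilon>\<^sup>2 / 2 * (?h\<^sup>2 * ?I w (?C w)) \<le> \<epsilon>\<^sup>2 / 2 * (\<theta> / 2 * (2 * M\<^sup>2 * L ^ 4 * W) + A / (2 * \<theta>))"
    by (intro mult_left_mono) auto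
  also have "\<dots> = D / 2 * W + \<epsilon>\<^sup>2 / (4 * \<theta>) * A"
    using M L \<epsilon> by (simp add: \<theta>_def field_simps)
  also have "\<dots> \<le> D / 2 * W + 1 / \<tau> * A"
  proof -
    \<comment> \<open>The coefficient left on \<open>A\<close> is the reciprocal of the admissible
      time step; this is where the restriction on \<open>\<tau>\<close> acts.\<close>
    have "\<epsilon>\<^sup>2 / (4 * \<theta>) = 1 / (4 * D / (M\<^sup>2 * L ^ 4 * \<epsilon> ^ 4))"
      using M L \<epsilon> D by (simp add: \<theta>_def field_simps power4_eq_xxxx power2_eq_square)
    also have "\<dots> \<le> 1 / \<tau>" using \<tau> by (intro frac_le) (simp_all add: D_def)
    finally show ?thesis using nonneg(1) by (intro add_left_mono mult_right_mono)
  qed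
  finally have conv_le: "\<epsilon>\<^sup>2 / 2 * (?h\<^sup>2 * ?I w (?C w)) \<le> D / 2 * W + 1 / \<tau> * A" .

  have m1: "(grid_norm_m1 L N w)\<^sup>2 = A" "(grid_norm_m1 L N v)\<^sup>2 = B"
    using grid_norm_m1_sq[OF L wz] grid_norm_m1_sq[OF L vz] by (simp_all add: A_def B_def \<phi>_def \<psi>_def)
  have "energy L N J \<epsilon> K c - energy L N J \<epsilon> K b \<le>
      (B - 5 * A) / (4 * \<tau>) + \<beta> * W + \<beta> / 2 * V - \<epsilon>\<^sup>2 * ?J1 / 2 * W + (D / 2 * W + 1 / \<tau> * A)"
    using lower upper conv_le by linarith
  \<comment> \<open>The coefficients balance: \<open>-5/(4\<tau>) + 1/\<tau> = -1/(4\<tau>)\<close>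
    on \<open>A\<close>, and on \<open>W\<close> the kernel mass in \<open>D/2\<close> cancels,
    leaving \<open>\<beta> - 3\<beta>/2 = -\<beta>/2\<close>. These are exactly the weights of the
    modified energy.\<close>
  also have "\<dots> = (\<beta> / 2 * V + 1 / (4 * \<tau>) * B) - (\<beta> / 2 * W + 1 / (4 * \<tau>) * A)"
    using \<tau>(1) by (simp add: D_def field_simps)
  finally show ?thesis
    unfolding v_def[symmetric] w_def[symmetric]
    by (simp add: mod_energy_def m1 W_def[symmetric] V_def[symmetric])
qed

text \<open>Summing the scheme over the grid kills the Laplacian, so the masses satisfy
  \<open>3 m'' - 4 m' + m = 0\<close> at consecutive levels. Equality of the two older masses then
  passes to the newest, starting from the assumption on the first two levels.\<close>

lemma scheme_2LI_increment_zero_mean: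
  assumes L: "L > 0" "N \<ge> 1" and \<tau>: "\<tau> > 0" and Cper: "\<And>n. u n \<in> Cper N"
    and init: "grid_inner N (u 1) grid_one = grid_inner N (u 0) grid_one"
    and scheme: "scheme_2LI L N J \<epsilon> K \<tau> u"
  shows "(\<lambda>i j. u (Suc n) i j - u n i j) \<in> zero_mean N"
proof -
  have "gsum N (u (Suc n)) = gsum N (u n)" for n
  proof (induction n)
    case 0
    then show ?case using init by (simp add: grid_inner_gsum grid_one_def)
  next
    case (Suc n)
    let ?\<omega> = "chem_pot L N J \<epsilon> K (u (Suc (Suc n))) (u (Suc n)) (u n)"
    have "?\<omega> \<in> Cper N"
      using Cper Cper_conv[OF Cper, of L J] by (simp add: chem_pot_def Cper_def)
    then have "gsum N (lap L N ?\<omega>) = 0"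
      using gsum_neg_lap[OF L] by (simp add: grid_inner_gsum grid_one_def neg_lap_def gsum_minus)
    moreover have "lap L N ?\<omega> =
        (\<lambda>i j. (3 * u (Suc (Suc n)) i j - 4 * u (Suc n) i j + u n i j) / (2 * \<tau>))"
      using scheme[unfolded scheme_2LI_def, rule_format, of "Suc n"] by (intro ext) simp
    ultimately have "3 * gsum N (u (Suc (Suc n))) - 4 * gsum N (u (Suc n)) + gsum N (u n) = 0"
      using \<tau> by (simp add: gsum_linear)
    then show ?case using Suc by simp
  qed
  then show ?thesis
    using Cper by (simp add: zero_mean_def Cper_def grid_inner_gsum grid_one_def gsum_diff)
qed

theorem theorem4p4:
  fixes L :: real and J :: "real \<times> real \<Rightarrow> real"
  assumes "L > 0" and "admissible_kernel L J"
  shows "\<exists>C\<^sub>J>0. \<forall>(N::nat) (\<epsilon>::real) (K::real) (\<beta>::real) (\<tau>::real) (u :: nat \<Rightarrow> grid_fun).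
    N \<ge> 1 \<longrightarrow> \<epsilon> > 0 \<longrightarrow>
    gamma_cont \<epsilon> L J > 0 \<longrightarrow> gamma_disc \<epsilon> L N J > 0 \<longrightarrow>
    K > 1 \<longrightarrow>
    \<beta> > 0 \<longrightarrow> (\<forall>s. \<bar>deriv (deriv (FK K)) s\<bar> \<le> \<beta>) \<longrightarrow>
    \<beta> \<le> (gamma_disc \<epsilon> L N J + 1) / 3 \<longrightarrow>
    \<tau> > 0 \<longrightarrow> \<tau> \<le> 2 * (gamma_disc \<epsilon> L N J + 1 - 3 * \<beta>) / (C\<^sub>J * \<epsilon> ^ 4) \<longrightarrow>
    (\<forall>n. u n \<in> Cper N) \<longrightarrow>
    grid_inner N (u 1) grid_one = grid_inner N (u 0) grid_one \<longrightarrow>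
    scheme_2LI L N J \<epsilon> K \<tau> u \<longrightarrow>
    (\<forall>n\<ge>1. mod_energy L N J \<epsilon> K \<beta> \<tau> (u (n + 1)) (increment u (n + 1))
           \<le> mod_energy L N J \<epsilon> K \<beta> \<tau> (u n) (increment u n))"
proof -
  have smooth: "k_smooth 1 J" and even: "\<And>x. J (- x) = J x"
    and per: "\<And>x y. J (x + L, y) = J (x, y)" "\<And>x y. J (x, y + L) = J (x, y)"
    using assms(2) by (auto simp: admissible_kernel_def smooth_def simp del: k_smooth.simps)
  have "0 \<le> 2 * L" using assms(1) by simp
  then obtain M where M: "M > 0" and lip: "lipschitz_on_box M (2 * L) J"
    using k_smooth_1_lipschitz_on_box[OF smooth] by blast
  \<comment> \<open>Fixed by \<open>J\<close> and \<open>L\<close> before \<open>N\<close> is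
    chosen, hence independent of the mesh. As \<open>gamma_disc + 1\<close> equals
    \<open>\<epsilon>^2 * conv_one\<close>, the halving turns the factor 2 in the time step bound
    into the 4 of the one-step estimate.\<close>
  define C where "C = M\<^sup>2 * L ^ 4 / 2"
  show ?thesis
  proof (intro exI[of _ C] conjI allI impI)
    show "C > 0" using M assms(1) by (simp add: C_def)
    fix N :: nat and \<epsilon> K \<beta> \<tau> :: real and u :: "nat \<Rightarrow> grid_fun" and n :: nat
    assume N: "N \<ge> 1" and \<epsilon>: "\<epsilon> > 0" and K: "K > 1"
      and \<beta>: "\<forall>s. \<bar>deriv (deriv (FK K)) s\<bar> \<le> \<beta>"
      and \<tau>: "\<tau> > 0" "\<tau> \<le> 2 * (gamma_disc \<epsilon> L N J + 1 - 3 * \<beta>) / (C * \<epsilon> ^ 4)"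
      and u: "\<forall>n. u n \<in> Cper N" "grid_inner N (u 1) grid_one = grid_inner N (u 0) grid_one"
      and scheme: "scheme_2LI L N J \<epsilon> K \<tau> u" and n: "n \<ge> 1"
    \<comment> \<open>Writing \<open>n\<close> as a successor makes \<open>n - 1\<close> the true
      predecessor \<open>m\<close>, free of truncated subtraction.\<close>
    obtain m where m: "n = Suc m" using n by (cases n) auto
    note zm = scheme_2LI_increment_zero_mean[OF assms(1) N \<tau>(1) u(1)[rule_format] u(2) scheme]
    have \<tau>': "\<tau> \<le> 4 * (\<epsilon>\<^sup>2 * conv_one L N J - 3 * \<beta>) / (M\<^sup>2 * L ^ 4 * \<epsilon> ^ 4)"
      using \<tau>(2) by (simp add: C_def gamma_disc_def)
    have step: "(3 * u (Suc n) i j - 4 * u n i j + u m i j) / (2 * \<tau>)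
        = lap L N (chem_pot L N J \<epsilon> K (u (Suc n)) (u n) (u m)) i j" for i j
      using scheme[unfolded scheme_2LI_def, rule_format, of n] n m by simp
    show "mod_energy L N J \<epsilon> K \<beta> \<tau> (u (n + 1)) (increment u (n + 1))
        \<le> mod_energy L N J \<epsilon> K \<beta> \<tau> (u n) (increment u n)"
      using scheme_step_energy_le[OF assms(1) N Cper_grid_kernel[OF N per] even lip M \<epsilon> _
          \<beta>[rule_format] \<tau>(1) \<tau>' u(1)[rule_format] u(1)[rule_format] u(1)[rule_format]
          _ zm[of n] step] zm[of m] K
      by (simp add: increment_def m)
  qed
qed

end
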